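(* Consider (one round of) the device handshake procedure described in the context, with Bob $B$ controlling his human $I_B$ and device $D_B$, Alice $A$ controlling her human $I_A$, her device $D_A$ and the configuration $Q_A=\{I_A,D_A,D_B\}$, and a source of randomness $S$. Suppose that Bob knows that the following assumptions are valid: (a) $\copyright P:\ \langle\cdot[a_{Q}]\cdot\rangle_{Q}\xrightarrow{\mathrm{vis}}(\cdot[a_{Q}]\cdot)_P$, i.e. the visual channel is read-authentic, at least for messages about events: the controller of $P$, upon $P$ receiving on a visual channel the message $[a_Q]$ about an event $a$ at $Q$, knows that it was sent by $Q$ before it was received; (b) $(:x:)_{Q_A}\Rightarrow x\in\Gamma_{D_A}\cap\Gamma_{D_B}$, i.e. $Q_A$ distributes the same value to $D_A$ and $D_B$; (c) $(:t:)_{Q_A}\Rightarrow \big(\nu[x]_S\to\langle:x:\rangle_S\to(:t:)_{Q_A}\big)\wedge t=x$, i.e. $Q_A$ is honest: whatever it samples is the fresh value $x$ previously generated and emitted by $S$; (d) $\langle\cdot\checkmark\cdot\rangle_{D_A}\Rightarrow \mathrm{ok}_{D_A}\wedge\big(\langle:f^A:\rangle_{I_A}\to(:f^A:)_{D_A}\to\langle\cdot\checkmark\cdot\rangle_{D_A}\big)$, i.e. $D_A$ is honest; (e) $\langle\cdot\checkmark\cdot\rangle_{D_B}\Rightarrow\mathrm{ok}_{D_B}$, i.e. $D_B$ is honest. Then, upon the completion of a run of the procedure, Bob can be sure that his and Alice's devices share a key: from his own observations of the run, namely that $I_B$ received on the visual channels the message $[(:\ :)_{Q_A}]$ from $Q_A$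 and the confirmations $\checkmark$ from $D_A$ and from $D_B$, Bob can derive that there is a value $x$ (the value sampled by $Q_A$ from $S$) with $x\in\Gamma_{D_A}\cap\Gamma_{D_B}$.
   Context: **Actor-networks.** An actor-network has a set of principals, a set of nodes, a set of configurations (a configuration is a node, or a finite set of nodes or of configurations), a set of channels, each with a type, an entry configuration and an exit configuration, and a partial map $\copyright$ from configurations to principals ($\copyright P$ is the principal controlling $P$). **Terms and events.** Data are elements of a polynomial extension of an algebra with associative pairing with projections; indeterminates $x$ represent freshly generated random values. Events are localized at configurations. At configuration $P$: $\langle\cdot t\cdot\rangle_P$ is "send $t$"; $(\cdot t\cdot)_P$ is "receive $t$"; $\langle:t:\rangle_P$ is "emit $t$" (coaction of a source); $(:t:)_P$ is "sample $t$"; $\nu[x]_P$ is "generate fresh $x$". $(:\ :)_P$ denotes the action of sampling at $P$, with the sampled data not displayed (i.e. $P$ sampled some term). $\checkmark$ is a fixed constant. For an event $a$ at $Q$, $[a_Q]$ denotes the term that represents this event; a message $[a_Q]$ sent by $Q$ is a message about the event $a_Q$ that took place at $Q$ (here: $Q$ visibly performing $a$). $\Gamma_N$ denotes the set of terms known to (held by) the node $N$. **Processes and runs.** A process is a partially ordered multiset of localized events (well-founded time order $\to$). A run of a process matches sends with receives, and emits with samples, along channels, consistently with the order; each write event (send or emit) precedes the corresponding read event (receive or sample), and this extends the order $\to$. $e\xrightarrow{\tau}e'$ denotes such a flow along a channel of type $\tau$. **Assertions.** A statement $A:\Phi$ means that principal $A$ asserts $\Phi$. Atomic predicates: $a[t]_P$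 ("event $a[t]$ happened at $P$") and $a[t]_P\to b[s]_{P'}$ ("$a[t]_P$ happened before $b[s]_{P'}$"); chains assert all consecutive orderings. $B:\Psi\Rightarrow\Phi$ means that $B$ knows $\Phi$ holds whenever his view $\Psi$ of the run holds. A principal can directly observe the events at the configurations it controls. General axioms available to principals: for all $P$, $\copyright P:\ (\cdot t\cdot)_P\Rightarrow\exists X.\ \langle\cdot t\cdot\rangle_X\to(\cdot t\cdot)_P$ and $\copyright P:\ (:t:)_P\Rightarrow\exists X.\ \langle:t:\rangle_X\to(:t:)_P$. **Device handshake network.** Principals Alice $A$ and Bob $B$. Nodes: devices $D_A$, $D_B$ of Alice and Bob; humans $I_A$, $I_B$; a source of randomness $S$. Configuration $Q_A=\{I_A,D_A,D_B\}$ (Alice holding both devices in her hand), controlled by $A$. Channels: two cyber channels $D_A\leftrightarrows D_B$; a biometric channel (bio) $I_A\to D_A$; visual channels (vis) $D_A\to I_A$, $D_B\to I_B$ and $Q_A\to I_B$ (through the last, as $D_A\in Q_A$ and $D_B\in Q_A$ are held up by Alice, $I_B$ also sees their displays); a physical channel (shk) $S\to Q_A$, conveying randomness to $D_A$ and $D_B$ when the devices are shaken together. **Device handshake procedure (one round, Alice shaking).** Alice forms $Q_A$ and shakes the two devices together. The run consists of five flows: 1. $\langle:x:\rangle_S\xrightarrow{\mathrm{shk}}(:x:)_{Q_A}$: $Q_A$ samples a freshly generated $x$ from $S$; 2. $\langle:f^A:\rangle_{I_A}\xrightarrow{\mathrm{bio}}(:f^A:)_{D_A}$: simultaneously, $D_A$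 samples $I_A$'s fingerprint $f^A$; 3. $\langle\cdot[(:\ :)_{Q_A}]\cdot\rangle_{Q_A}\xrightarrow{\mathrm{vis}}(\cdot[(:\ :)_{Q_A}]\cdot)_{I_B}$: $Q_A$ shows $I_B$ that she shakes the devices to sample; 4. $\langle\cdot\checkmark\cdot\rangle_{D_A}\xrightarrow{\mathrm{vis}}(\cdot\checkmark\cdot)_{I_B}$: confirmation to $I_B$ that $D_A$ received $x$ and a correct $f^A$; 5. $\langle\cdot\checkmark\cdot\rangle_{D_B}\xrightarrow{\mathrm{vis}}(\cdot\checkmark\cdot)_{I_B}$: confirmation to $I_B$ that $D_B$ received $x$. $\mathrm{ok}_{D_A}$ asserts that $D_A$ has successfully received $x$ (and verified the fingerprint), and $\mathrm{ok}_{D_B}$ asserts that $D_B$ has successfully received $x$. The key in question is the sampled value $x$. *)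

theory Defs
  imports Main "HOL-Library.FSet"
begin

section \<open>Actor-networks\<close>

datatype (nodes_of: 'n) cfg = Node 'n | Group "'n cfg fset"

fun members :: "'n cfg \<Rightarrow> 'n cfg set" where
  "members (Node n) = {}"
| "members (Group C) = fset C"

record ('p, 'n, 'c, 'k) network =
  principals :: "'p set"
  nodes :: "'n set"
  configs :: "'n cfg set"
  channels :: "'c set"
  ctype :: "'c \<Rightarrow> 'k"
  entry :: "'c \<Rightarrow> 'n cfg"
  exit :: "'c \<Rightarrow> 'n cfg"
  ctrl :: "'n cfg \<Rightarrow> 'p option"

definition actor_network :: "('p, 'n, 'c, 'k) network \<Rightarrow> bool" where
  "actor_network N \<longleftrightarrow>
     Node ` nodes N \<subseteq> configs N \<and>
     (\<forall>P \<in> configs N. nodes_of P \<subseteq> nodes N) \<and>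
     entry N ` channels N \<subseteq> configs N \<and>
     exit N ` channels N \<subseteq> configs N \<and>
     dom (ctrl N) \<subseteq> configs N \<and> ran (ctrl N) \<subseteq> principals N"

text \<open>
  A channel whose entry is a compound configuration also carries what its members write:
  whoever watches the configuration sees the displays of the devices in it.
\<close>
definition carries :: "('p, 'n, 'c, 'k) network \<Rightarrow> 'c \<Rightarrow> 'n cfg \<Rightarrow> 'n cfg \<Rightarrow> bool" where
  "carries N c P Q \<longleftrightarrow>
     c \<in> channels N \<and> P \<in> insert (entry N c) (members (entry N c)) \<and> Q = exit N c"


section \<open>Terms and events\<close>

datatype ('t, 'x) event = Send 't | Recv 't | Emit 't | Sample 't | Gen 'x

fun is_read :: "('t, 'x) event \<Rightarrow> bool" where
  "is_read (Recv t) = True"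
| "is_read (Sample t) = True"
| "is_read _ = False"

fun matches :: "('t, 'x) event \<Rightarrow> ('t, 'x) event \<Rightarrow> bool" where
  "matches (Send s) (Recv t) = (s = t)"
| "matches (Emit s) (Sample t) = (s = t)"
| "matches _ _ = False"

text \<open>
  What an event message displays of an event: all of it, or, for \<open>(: :)\<close>, only that
  something was sampled.
\<close>
datatype ('t, 'x) descr = Shown "('t, 'x) event" | Sampling

fun fits :: "('t, 'x) descr \<Rightarrow> ('t, 'x) event \<Rightarrow> bool" where
  "fits (Shown b) a = (a = b)"
| "fits Sampling a = (\<exists>t. a = Sample t)"

record ('n, 't, 'x, 'f) data =
  pair :: "'t \<Rightarrow> 't \<Rightarrow> 't"
  comps :: "'t \<Rightarrow> 't list"
  oper :: "'f \<Rightarrow> 't list \<Rightarrow> 't"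
  base :: "'t set"
  indet :: "'x \<Rightarrow> 't"
  check :: 't
  evt :: "('t, 'x) descr \<Rightarrow> 'n cfg \<Rightarrow> 't"

text \<open>
  Binary projections with \<open>fst (pair s t) = s\<close> and \<open>snd (pair s t) = t\<close> are inconsistent with
  associativity of pairing (all terms would be equal), so the projections of a tuple are
  the entries of the list of its components.  The last conjunct is the universal property of the
  polynomial extension of \<open>base\<close> by the indeterminates: each substitution of terms for
  indeterminates extends uniquely to a homomorphism over \<open>base\<close>.
\<close>
definition data_algebra :: "('n, 't, 'x, 'f) data \<Rightarrow> bool" where
  "data_algebra T \<longleftrightarrow>
     (\<forall>s t u. pair T (pair T s t) u = pair T s (pair T t u)) \<and>
     (\<forall>s t. comps T (pair T s t) = comps T s @ comps T t) \<and>
     (\<forall>t. \<forall>c \<in> set (comps T t). comps T c = [c]) \<and>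
     inj (comps T) \<and>
     (\<forall>s \<in> base T. \<forall>t \<in> base T. pair T s t \<in> base T) \<and>
     (\<forall>t \<in> base T. set (comps T t) \<subseteq> base T) \<and>
     (\<forall>f ts. set ts \<subseteq> base T \<longrightarrow> oper T f ts \<in> base T) \<and>
     check T \<in> base T \<and>
     inj (\<lambda>(a, Q). evt T a Q) \<and>
     inj (indet T) \<and>
     (\<forall>x. comps T (indet T x) = [indet T x]) \<and>
     (\<forall>\<sigma>. \<exists>!h. (\<forall>t \<in> base T. h t = t) \<and> (\<forall>x. h (indet T x) = \<sigma> x) \<and>
        (\<forall>s t. h (pair T s t) = pair T (h s) (h t)) \<and>
        (\<forall>f ts. h (oper T f ts) = oper T f (map h ts)))"


section \<open>Processes and runs\<close>

record ('e, 'n, 't, 'x) process =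
  evs :: "'e set"
  act :: "'e \<Rightarrow> ('t, 'x) event"
  loc :: "'e \<Rightarrow> 'n cfg"
  order :: "('e \<times> 'e) set"

definition is_process ::
    "('p, 'n, 'c, 'k) network \<Rightarrow> ('e, 'n, 't, 'x, 'z) process_scheme \<Rightarrow> bool" where
  "is_process N F \<longleftrightarrow>
     loc F ` evs F \<subseteq> configs N \<and>
     order F \<subseteq> evs F \<times> evs F \<and> trans (order F) \<and> wf (order F)"

text \<open>
  \<open>src\<close> and \<open>via\<close> give the write event matched with a read event and the
  channel in between; \<open>\<Gamma>\<close> gives the terms held by each node.
\<close>
record ('e, 'n, 't, 'x, 'c) run = "('e, 'n, 't, 'x) process" +
  src :: "'e \<Rightarrow> 'e"
  via :: "'e \<Rightarrow> 'c"
  \<Gamma> :: "'n \<Rightarrow> 't set"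

definition reads :: "('e, 'n, 't, 'x, 'c) run \<Rightarrow> 'e set" where
  "reads r = {e \<in> evs r. is_read (act r e)}"

definition before :: "('e, 'n, 't, 'x, 'c) run \<Rightarrow> ('e \<times> 'e) set" where
  "before r = (order r \<union> {(src r e, e) | e. e \<in> reads r})\<^sup>+"

definition is_run :: "('p, 'n, 'c, 'k) network \<Rightarrow> ('e, 'n, 't, 'x, 'c) run \<Rightarrow> bool" where
  "is_run N r \<longleftrightarrow>
     is_process N r \<and>
     (\<forall>e \<in> reads r. src r e \<in> evs r \<and> matches (act r (src r e)) (act r e) \<and>
        carries N (via r e) (loc r (src r e)) (loc r e)) \<and>
     wf (before r)"

definition flow ::
    "('p, 'n, 'c, 'k) network \<Rightarrow> ('e, 'n, 't, 'x, 'c) run \<Rightarrow> 'k \<Rightarrow> 'e \<Rightarrow> 'e \<Rightarrow> bool" where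
  "flow N r \<tau> d e \<longleftrightarrow> e \<in> reads r \<and> d = src r e \<and> ctype N (via r e) = \<tau>"

definition at_event ::
    "('e, 'n, 't, 'x, 'c) run \<Rightarrow> 'e \<Rightarrow> ('t, 'x) event \<Rightarrow> 'n cfg \<Rightarrow> bool" where
  "at_event r e a P \<longleftrightarrow> e \<in> evs r \<and> act r e = a \<and> loc r e = P"

definition happened :: "('e, 'n, 't, 'x, 'c) run \<Rightarrow> ('t, 'x) event \<Rightarrow> 'n cfg \<Rightarrow> bool" where
  "happened r a P \<longleftrightarrow> (\<exists>e. at_event r e a P)"

definition happened_before ::
    "('e, 'n, 't, 'x, 'c) run \<Rightarrow> ('t, 'x) event \<Rightarrow> 'n cfg \<Rightarrow> ('t, 'x) event \<Rightarrow> 'n cfg \<Rightarrow> bool" where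
  "happened_before r a P b Q \<longleftrightarrow>
     (\<exists>d e. at_event r d a P \<and> at_event r e b Q \<and> (d, e) \<in> before r)"

definition flow_from_to ::
    "('p, 'n, 'c, 'k) network \<Rightarrow> ('e, 'n, 't, 'x, 'c) run \<Rightarrow>
     'k \<Rightarrow> ('t, 'x) event \<Rightarrow> 'n cfg \<Rightarrow> ('t, 'x) event \<Rightarrow> 'n cfg \<Rightarrow> bool" where
  "flow_from_to N r \<tau> a P b Q \<longleftrightarrow>
     (\<exists>d e. at_event r d a P \<and> at_event r e b Q \<and> flow N r \<tau> d e)"


section \<open>Knowledge\<close>

definition observed ::
    "('p, 'n, 'c, 'k) network \<Rightarrow> 'p \<Rightarrow> ('e, 'n, 't, 'x, 'c) run \<Rightarrow> 'e set" where
  "observed N A r = {e \<in> evs r. ctrl N (loc r e) = Some A}"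

text \<open>
  A principal sees the events at the configurations it controls, with their order and, for
  reads, the channel -- but not the location of the matching write event.  Runs
  are multisets, so views are compared up to renaming of events.
\<close>
definition same_view ::
    "('p, 'n, 'c, 'k) network \<Rightarrow> 'p \<Rightarrow>
     ('e, 'n, 't, 'x, 'c) run \<Rightarrow> ('e, 'n, 't, 'x, 'c) run \<Rightarrow> bool" where
  "same_view N A r r' \<longleftrightarrow>
     (\<exists>f. bij_betw f (observed N A r) (observed N A r') \<and>
        (\<forall>e \<in> observed N A r. act r' (f e) = act r e \<and> loc r' (f e) = loc r e \<and>
           (is_read (act r e) \<longrightarrow> via r' (f e) = via r e)) \<and>
        (\<forall>d \<in> observed N A r. \<forall>e \<in> observed N A r.
           (f d, f e) \<in> before r' \<longleftrightarrow> (d, e) \<in> before r))"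

text \<open>
  \<open>W\<close> is the set of runs that the principals consider possible.  A principal knows, in the run
  \<open>r\<close>, whatever holds in all possible runs with the same view.
\<close>
definition knows ::
    "('p, 'n, 'c, 'k) network \<Rightarrow> ('e, 'n, 't, 'x, 'c) run set \<Rightarrow> 'p \<Rightarrow>
     (('e, 'n, 't, 'x, 'c) run \<Rightarrow> bool) \<Rightarrow> ('e, 'n, 't, 'x, 'c) run \<Rightarrow> bool" where
  "knows N W A \<Phi> r \<longleftrightarrow> (\<forall>r' \<in> W. same_view N A r r' \<longrightarrow> \<Phi> r')"


section \<open>The device handshake\<close>

datatype prin = Alice | Bob
datatype node = D_A | D_B | I_A | I_B | S
datatype ckind = Cyber | Bio | Vis | Shk
datatype chan = Cyb_DA_DB | Cyb_DB_DA | Bio_IA_DA | Vis_DA_IA | Vis_DB_IB | Vis_QA_IB | Shk_S_QA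

definition Q_A :: "node cfg" where
  "Q_A = Group {|Node I_A, Node D_A, Node D_B|}"

fun hs_type :: "chan \<Rightarrow> ckind" where
  "hs_type Cyb_DA_DB = Cyber"
| "hs_type Cyb_DB_DA = Cyber"
| "hs_type Bio_IA_DA = Bio"
| "hs_type Vis_DA_IA = Vis"
| "hs_type Vis_DB_IB = Vis"
| "hs_type Vis_QA_IB = Vis"
| "hs_type Shk_S_QA = Shk"

fun hs_entry :: "chan \<Rightarrow> node cfg" where
  "hs_entry Cyb_DA_DB = Node D_A"
| "hs_entry Cyb_DB_DA = Node D_B"
| "hs_entry Bio_IA_DA = Node I_A"
| "hs_entry Vis_DA_IA = Node D_A"
| "hs_entry Vis_DB_IB = Node D_B"
| "hs_entry Vis_QA_IB = Q_A"
| "hs_entry Shk_S_QA = Node S"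

fun hs_exit :: "chan \<Rightarrow> node cfg" where
  "hs_exit Cyb_DA_DB = Node D_B"
| "hs_exit Cyb_DB_DA = Node D_A"
| "hs_exit Bio_IA_DA = Node D_A"
| "hs_exit Vis_DA_IA = Node I_A"
| "hs_exit Vis_DB_IB = Node I_B"
| "hs_exit Vis_QA_IB = Node I_B"
| "hs_exit Shk_S_QA = Q_A"

definition handshake_net :: "(prin, node, chan, ckind) network" where
  "handshake_net =
     \<lparr>principals = UNIV, nodes = UNIV, configs = insert Q_A (range Node), channels = UNIV,
      ctype = hs_type, entry = hs_entry, exit = hs_exit,
      ctrl = [Node I_A \<mapsto> Alice, Node D_A \<mapsto> Alice, Q_A \<mapsto> Alice,
              Node I_B \<mapsto> Bob, Node D_B \<mapsto> Bob]\<rparr>"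

lemma actor_network_handshake_net: "actor_network handshake_net"
proof -
  have "hs_entry c \<in> insert Q_A (range Node)" "hs_exit c \<in> insert Q_A (range Node)" for c
    by (cases c; simp)+
  then show ?thesis
    by (auto simp: actor_network_def handshake_net_def)
qed

text \<open>
  The meaning of an event message: the \<open>[a\<^sub>Q]\<close> that \<open>Q\<close> itself shows on a visual channel
  is \<open>Q\<close> visibly performing \<open>a\<close>, so it is about an event that took place.
\<close>
definition shows_events ::
    "('p, 'n, 'c, ckind) network \<Rightarrow> ('n, 't, 'x, 'f) data \<Rightarrow> ('e, 'n, 't, 'x, 'c) run \<Rightarrow> bool" where
  "shows_events N T r \<longleftrightarrow>
     (\<forall>a P Q. flow_from_to N r Vis (Send (evt T a Q)) Q (Recv (evt T a Q)) P \<longrightarrow>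
        (\<exists>b. fits a b \<and> happened r b Q))"

definition handshake_runs ::
    "(node, 't, 'x, 'f) data \<Rightarrow> ('e, node, 't, 'x, chan) run set" where
  "handshake_runs T = {r. is_run handshake_net r \<and> shows_events handshake_net T r}"

definition completes_handshake ::
    "(node, 't, 'x, 'f) data \<Rightarrow> 't \<Rightarrow> ('e, node, 't, 'x, chan) run \<Rightarrow> bool" where
  "completes_handshake T fA r \<longleftrightarrow>
     (\<exists>x. happened_before r (Gen x) (Node S) (Emit (indet T x)) (Node S) \<and>
        flow_from_to handshake_net r Shk (Emit (indet T x)) (Node S) (Sample (indet T x)) Q_A) \<and>
     flow_from_to handshake_net r Bio (Emit fA) (Node I_A) (Sample fA) (Node D_A) \<and>
     flow_from_to handshake_net r Vis
       (Send (evt T Sampling Q_A)) Q_A (Recv (evt T Sampling Q_A)) (Node I_B) \<and>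
     flow_from_to handshake_net r Vis
       (Send (check T)) (Node D_A) (Recv (check T)) (Node I_B) \<and>
     flow_from_to handshake_net r Vis
       (Send (check T)) (Node D_B) (Recv (check T)) (Node I_B)"

text \<open>
  \<open>I_B\<close> receives \<open>t\<close> on a visual channel showing \<open>P\<close>.  This is determined by what \<open>I_B\<close>
  sees; that \<open>P\<close> is the actual sender is not part of it.
\<close>
definition sees :: "('e, node, 't, 'x, chan) run \<Rightarrow> 'e \<Rightarrow> 't \<Rightarrow> node cfg \<Rightarrow> bool" where
  "sees r e t P \<longleftrightarrow>
     at_event r e (Recv t) (Node I_B) \<and> ctype handshake_net (via r e) = Vis \<and>
     carries handshake_net (via r e) P (Node I_B)"

definition bob_observes ::
    "(node, 't, 'x, 'f) data \<Rightarrow> ('e, node, 't, 'x, chan) run \<Rightarrow> bool" where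
  "bob_observes T r \<longleftrightarrow>
     (\<exists>e. sees r e (evt T Sampling Q_A) Q_A) \<and>
     (\<exists>d e. d \<noteq> e \<and> sees r d (check T) (Node D_A) \<and> sees r e (check T) (Node D_B))"

definition vis_read_authentic ::
    "('p, 'n, 'c, ckind) network \<Rightarrow> ('n, 't, 'x, 'f) data \<Rightarrow>
     ('e, 'n, 't, 'x, 'c) run set \<Rightarrow> ('e, 'n, 't, 'x, 'c) run \<Rightarrow> bool" where
  "vis_read_authentic N T W r \<longleftrightarrow>
     (\<forall>P A. ctrl N P = Some A \<longrightarrow>
        knows N W A
          (\<lambda>r. \<forall>a Q e. at_event r e (Recv (evt T a Q)) P \<and> ctype N (via r e) = Vis \<longrightarrow>
             (\<exists>d. at_event r d (Send (evt T a Q)) Q \<and> flow N r Vis d e \<and> (d, e) \<in> before r))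
          r)"

definition same_value_distributed ::
    "(node, 't, 'x, 'f) data \<Rightarrow> ('e, node, 't, 'x, chan) run \<Rightarrow> bool" where
  "same_value_distributed T r \<longleftrightarrow>
     (\<forall>x. happened r (Sample (indet T x)) Q_A \<longrightarrow> indet T x \<in> \<Gamma> r D_A \<inter> \<Gamma> r D_B)"

definition honest_QA ::
    "(node, 't, 'x, 'f) data \<Rightarrow> ('e, node, 't, 'x, chan) run \<Rightarrow> bool" where
  "honest_QA T r \<longleftrightarrow>
     (\<forall>t. happened r (Sample t) Q_A \<longrightarrow>
        (\<exists>x. happened_before r (Gen x) (Node S) (Emit (indet T x)) (Node S) \<and>
           happened_before r (Emit (indet T x)) (Node S) (Sample t) Q_A \<and>
           t = indet T x))"

definition received_key ::
    "(node, 't, 'x, 'f) data \<Rightarrow> node \<Rightarrow> ('e, node, 't, 'x, chan) run \<Rightarrow> bool" where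
  "received_key T D r \<longleftrightarrow>
     (\<exists>x. happened r (Sample (indet T x)) Q_A \<and> indet T x \<in> \<Gamma> r D)"

definition ok_DA ::
    "(node, 't, 'x, 'f) data \<Rightarrow> 't \<Rightarrow> ('e, node, 't, 'x, chan) run \<Rightarrow> bool" where
  "ok_DA T fA r \<longleftrightarrow> received_key T D_A r \<and> happened r (Sample fA) (Node D_A)"

definition ok_DB ::
    "(node, 't, 'x, 'f) data \<Rightarrow> ('e, node, 't, 'x, chan) run \<Rightarrow> bool" where
  "ok_DB T r \<longleftrightarrow> received_key T D_B r"

definition honest_DA ::
    "(node, 't, 'x, 'f) data \<Rightarrow> 't \<Rightarrow> ('e, node, 't, 'x, chan) run \<Rightarrow> bool" where
  "honest_DA T fA r \<longleftrightarrow>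
     (happened r (Send (check T)) (Node D_A) \<longrightarrow>
        ok_DA T fA r \<and>
        happened_before r (Emit fA) (Node I_A) (Sample fA) (Node D_A) \<and>
        happened_before r (Sample fA) (Node D_A) (Send (check T)) (Node D_A))"

definition honest_DB ::
    "(node, 't, 'x, 'f) data \<Rightarrow> ('e, node, 't, 'x, chan) run \<Rightarrow> bool" where
  "honest_DB T r \<longleftrightarrow> (happened r (Send (check T)) (Node D_B) \<longrightarrow> ok_DB T r)"

definition devices_share_key ::
    "(node, 't, 'x, 'f) data \<Rightarrow> ('e, node, 't, 'x, chan) run \<Rightarrow> bool" where
  "devices_share_key T r \<longleftrightarrow>
     (\<exists>x. flow_from_to handshake_net r Shk
            (Emit (indet T x)) (Node S) (Sample (indet T x)) Q_A \<and>
          indet T x \<in> \<Gamma> r D_A \<inter> \<Gamma> r D_B)"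

end

(* Everything Bob learns comes from the message about Q_A's sampling: it is authentic, so the
   sampling did take place, and honesty of Q_A makes its value a fresh x.  That x flowed from S
   because the shaking channel is the only one into Q_A.  The view of I_B is the same in all runs
   that Bob cannot distinguish, so the argument applies to each of them. *)
theory Submission
  imports Defs
begin

lemma same_view_refl: "same_view N A r r"
  unfolding same_view_def by (rule exI[of _ id]) auto

text \<open>The renaming of events behind \<open>same_view\<close> preserves action and location, so
  an event observed by \<open>A\<close> has a counterpart in \<open>r'\<close>. A view records
  channels of reads alone, hence the condition on \<open>via\<close>.\<close>

lemma same_view_event:
  assumes "same_view N A r r'" "at_event r e a P" "ctrl N P = Some A"
  obtains e' where "at_event r' e' a P" "is_read a \<Longrightarrow> via r' e' = via r e"
proof -
  obtain f where f: "bij_betw f (observed N A r) (observed N A r')"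
    and same: "\<And>e. e \<in> observed N A r \<Longrightarrow> act r' (f e) = act r e \<and> loc r' (f e) = loc r e \<and>
           (is_read (act r e) \<longrightarrow> via r' (f e) = via r e)"
    using assms(1) unfolding same_view_def by blast
  have "e \<in> observed N A r"
    using assms(2,3) by (simp add: observed_def at_event_def)
  with f have "f e \<in> evs r'"
    by (auto simp: observed_def dest: bij_betwE)
  then show thesis
    using that[of "f e"] same[OF \<open>e \<in> observed N A r\<close>] assms(2) by (simp add: at_event_def)
qed

lemma ctrl_I_B: "ctrl handshake_net (Node I_B) = Some Bob"
  by (simp add: handshake_net_def Q_A_def)

lemma run_src:
  assumes "is_run N r" "e \<in> reads r"
  shows "src r e \<in> evs r" "matches (act r (src r e)) (act r e)"
    "carries N (via r e) (loc r (src r e)) (loc r e)"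
  using assms by (auto simp: is_run_def)

text \<open>Among the channels, \<open>Shk_S_QA\<close> alone exits at \<open>Q_A\<close>; its entry
  \<open>Node S\<close> is a plain node, so no member can write in its place.\<close>

lemma carries_to_Q_A:
  assumes "carries handshake_net c P Q_A"
  shows "c = Shk_S_QA" "P = Node S"
  using assms by (cases c; simp add: carries_def handshake_net_def Q_A_def)+

text \<open>The second conclusion keeps the actual sender, which \<open>sees\<close> leaves out; it
  serves to tell two receptions apart.\<close>

lemma flow_sees:
  assumes "is_run handshake_net r"
    "flow_from_to handshake_net r Vis (Send t) P (Recv t) (Node I_B)"
  obtains e where "sees r e t P" "loc r (src r e) = P"
proof -
  obtain d e where de: "at_event r d (Send t) P" "at_event r e (Recv t) (Node I_B)"
    "flow handshake_net r Vis d e"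
    using assms(2) unfolding flow_from_to_def by blast
  then have "e \<in> reads r" "d = src r e" "ctype handshake_net (via r e) = Vis"
    by (simp_all add: flow_def)
  with run_src(3)[OF assms(1) \<open>e \<in> reads r\<close>] de show thesis
    using that[of e] by (simp add: sees_def at_event_def)
qed

lemma completes_handshake_imp_bob_observes:
  assumes "is_run handshake_net r" "completes_handshake T fA r"
  shows "bob_observes T r"
proof -
  have flows: "flow_from_to handshake_net r Vis
      (Send (evt T Sampling Q_A)) Q_A (Recv (evt T Sampling Q_A)) (Node I_B)"
    "flow_from_to handshake_net r Vis (Send (check T)) (Node D_A) (Recv (check T)) (Node I_B)"
    "flow_from_to handshake_net r Vis (Send (check T)) (Node D_B) (Recv (check T)) (Node I_B)"
    using assms(2) unfolding completes_handshake_def by simp_all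
  obtain e where e: "sees r e (evt T Sampling Q_A) Q_A"
    using flow_sees[OF assms(1) flows(1)] .
  obtain dA where dA: "sees r dA (check T) (Node D_A)" "loc r (src r dA) = Node D_A"
    using flow_sees[OF assms(1) flows(2)] .
  obtain dB where dB: "sees r dB (check T) (Node D_B)" "loc r (src r dB) = Node D_B"
    using flow_sees[OF assms(1) flows(3)] .
  \<comment> \<open>\<open>Vis_QA_IB\<close> carries the displays of both devices, so a single
    reception could satisfy both \<open>sees\<close> statements; the different senders exclude
    this.\<close>
  have "dA \<noteq> dB" using dA(2) dB(2) by auto
  with e dA(1) dB(1) show ?thesis unfolding bob_observes_def by blast
qed

text \<open>A sample is a read, so the run matches it with an emission of the same term, over a
  channel into \<open>Q_A\<close>; \<open>carries_to_Q_A\<close> identifies channel and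
  sender.\<close>

lemma sample_at_Q_A_flow:
  assumes "is_run handshake_net r" "happened r (Sample t) Q_A"
  shows "flow_from_to handshake_net r Shk (Emit t) (Node S) (Sample t) Q_A"
proof -
  obtain e where e: "at_event r e (Sample t) Q_A"
    using assms(2) unfolding happened_def by blast
  then have read: "e \<in> reads r" by (simp add: reads_def at_event_def)
  have "act r (src r e) = Emit t"
    using run_src(2)[OF assms(1) read] e by (cases "act r (src r e)") (simp_all add: at_event_def)
  moreover have "loc r (src r e) = Node S" "via r e = Shk_S_QA"
    using carries_to_Q_A run_src(3)[OF assms(1) read] e by (simp_all add: at_event_def)
  ultimately have "at_event r (src r e) (Emit t) (Node S)" "flow handshake_net r Shk (src r e) e"
    using read run_src(1)[OF assms(1) read]
    by (simp_all add: flow_def at_event_def handshake_net_def)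
  then show ?thesis
    using e unfolding flow_from_to_def by blast
qed

lemma sampling_message_imp_sampled:
  assumes "r \<in> W" "W \<subseteq> handshake_runs T" "vis_read_authentic handshake_net T W r"
    and "at_event r e (Recv (evt T Sampling Q_A)) (Node I_B)"
    and "ctype handshake_net (via r e) = Vis"
  obtains t where "happened r (Sample t) Q_A"
proof -
  \<comment> \<open>Authenticity is stated as knowledge of Bob; it is true in \<open>r\<close>
    itself because \<open>r\<close> lies in \<open>W\<close> and has the same view as
    itself.\<close>
  obtain d where "at_event r d (Send (evt T Sampling Q_A)) Q_A" "flow handshake_net r Vis d e"
    using assms(1,3-5) ctrl_I_B same_view_refl[of handshake_net Bob r]
    unfolding vis_read_authentic_def knows_def by meson
  then have "flow_from_to handshake_net r Vis
      (Send (evt T Sampling Q_A)) Q_A (Recv (evt T Sampling Q_A)) (Node I_B)"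
    using assms(4) unfolding flow_from_to_def by blast
  \<comment> \<open>The message is now known to be shown by \<open>Q_A\<close> itself, so
    \<open>shows_events\<close> applies. \<open>Sampling\<close> hides the sampled term, hence some
    unspecified \<open>t\<close>.\<close>
  then obtain b where "fits Sampling b" "happened r b Q_A"
    using assms(1,2) unfolding handshake_runs_def shows_events_def by blast
  then show thesis using that by auto
qed

theorem mainTheorem2:
  fixes T :: "(node, 't, 'x, 'f) data"
    and fA :: 't
    and W :: "('e, node, 't, 'x, chan) run set"
    and r :: "('e, node, 't, 'x, chan) run"
  assumes "data_algebra T"
    and "W \<subseteq> handshake_runs T"
    and "r \<in> W"
    and "knows handshake_net W Bob
           (\<lambda>r. vis_read_authentic handshake_net T W r \<and>
                same_value_distributed T r \<and>
                honest_QA T r \<and>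
                honest_DA T fA r \<and>
                honest_DB T r) r"
  shows "(completes_handshake T fA r \<longrightarrow> bob_observes T r) \<and>
         (bob_observes T r \<longrightarrow> knows handshake_net W Bob (devices_share_key T) r)"
proof (intro conjI impI)
  assume "completes_handshake T fA r"
  moreover have "is_run handshake_net r"
    using assms(2,3) unfolding handshake_runs_def by blast
  ultimately show "bob_observes T r"
    by (rule completes_handshake_imp_bob_observes[rotated])
next
  assume "bob_observes T r"
  then obtain e where e: "at_event r e (Recv (evt T Sampling Q_A)) (Node I_B)"
    "ctype handshake_net (via r e) = Vis"
    unfolding bob_observes_def sees_def by blast
  show "knows handshake_net W Bob (devices_share_key T) r"
    unfolding knows_def
  proof (intro ballI impI)
    fix r' assume r': "r' \<in> W" and view: "same_view handshake_net Bob r r'"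
    have run: "is_run handshake_net r'"
      using assms(2) r' unfolding handshake_runs_def by blast
    \<comment> \<open>Bob knows the assumptions in \<open>r\<close>, so they hold in every run that
      he cannot distinguish from it.\<close>
    have authentic: "vis_read_authentic handshake_net T W r'"
      and distributed: "same_value_distributed T r'" and honest: "honest_QA T r'"
      using assms(4)[unfolded knows_def, rule_format, OF r' view] by simp_all
    \<comment> \<open>A reception is a read, so its counterpart in \<open>r'\<close> keeps the
      channel and is visual too.\<close>
    obtain e' where "at_event r' e' (Recv (evt T Sampling Q_A)) (Node I_B)"
      "ctype handshake_net (via r' e') = Vis"
      by (rule same_view_event[OF view e(1) ctrl_I_B]) (use e(2) in simp)
    then obtain t where t: "happened r' (Sample t) Q_A"
      by (rule sampling_message_imp_sampled[OF r' assms(2) authentic])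
    then obtain x where "t = indet T x"
      using honest unfolding honest_QA_def by blast
    moreover have "flow_from_to handshake_net r' Shk (Emit t) (Node S) (Sample t) Q_A"
      using run t by (rule sample_at_Q_A_flow)
    ultimately show "devices_share_key T r'"
      using distributed t unfolding devices_share_key_def same_value_distributed_def by blast
  qed
qed

end
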